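(* Let $X$ be a Banach space, let $C$ be a nonempty, compact (in the norm topology), convex subset of $X$, and let $T:C\to C$ be a pointwise asymptotically nonexpansive mapping. Then $T$ has a fixed point, i.e. there exists $x\in C$ with $Tx=x$.
   Context: Let $C$ be a nonempty subset of a Banach space $(X,\Vert\cdot\Vert)$. A mapping $T:C\to C$ (no continuity is assumed) is pointwise asymptotically nonexpansive if for each $x\in C$ there exist $N(x)\in\mathbb{N}$ and a real sequence $(\alpha_n(x))_n$ with $\lim_{n\to\infty}\alpha_n(x)=1$ such that for all $n\ge N(x)$ one has $\Vert T^nx-T^ny\Vert\le \alpha_n(x)\Vert x-y\Vert$ for all $y\in C$. Here $T^n$ denotes the $n$-th iterate of $T$. *)

theory Defs
  imports "HOL-Analysis.Analysis"
begin

text \<open>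
  A self-map \<open>C \<rightarrow> C\<close> is rendered as a total function on the ambient type that maps
  \<open>C\<close> into itself; its values outside \<open>C\<close> are irrelevant, since the iterates are
  only evaluated at points of \<open>C\<close>.  Both \<open>N\<close> and the sequence \<open>\<alpha>\<close> may depend on \<open>x\<close>.
\<close>

definition pointwise_asymptotically_nonexpansive_on ::
    "'a::real_normed_vector set \<Rightarrow> ('a \<Rightarrow> 'a) \<Rightarrow> bool" where
  "pointwise_asymptotically_nonexpansive_on C T \<longleftrightarrow>
     T \<in> C \<rightarrow> C \<and>
     (\<forall>x\<in>C. \<exists>(N::nat) (\<alpha>::nat \<Rightarrow> real).
        \<alpha> \<longlonglongrightarrow> 1 \<and>
        (\<forall>n\<ge>N. \<forall>y\<in>C. norm ((T ^^ n) x - (T ^^ n) y) \<le> \<alpha> n * norm (x - y)))"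

end

theory Submission
  imports Defs
begin

text \<open>
  \<open>T\<close> need not be continuous, so the closure of a \<open>T\<close>-invariant set may fail to be \<open>T\<close>-invariant.
  The argument therefore replaces invariance under \<open>T\<close> by closedness under \<open>orbit_limits T\<close>, which
  sends \<open>x\<close> to the set of cluster points of the orbit \<open>T\<^sup>n x\<close>.  The defining estimate says that
  in the limit the iterates act nonexpansively, and that \<open>T\<^sup>n\<close> is continuous at \<open>x\<close> for all
  large \<open>n\<close>.

  Zorn's lemma provides a minimal nonempty compact convex set \<open>K\<close> with \<open>orbit_limits T x \<subseteq> K\<close> for
  all \<open>x \<in> K\<close>.  Let \<open>w \<in> K\<close> and \<open>M = orbit_limits T w\<close>.  If \<open>M\<close> had positive diameter, then, as
  in DeMarr's theorem on commuting nonexpansive maps, compactness would give a point of the convex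
  hull of \<open>M\<close> all of whose distances to \<open>M\<close> are at most some \<open>r < diameter M\<close>
  (\<open>convex_hull_center_beats_diameter\<close>).  The points of \<open>K\<close> within \<open>r\<close> of all of \<open>M\<close> then form a
  nonempty compact convex set that is again closed under \<open>orbit_limits T\<close>
  (\<open>orbit_limits_near_orbit_limits\<close>); by minimality it is all of \<open>K\<close>, so it contains \<open>M\<close>, which
  contradicts \<open>r < diameter M\<close>.

  Hence \<open>M\<close> is a single point \<open>p\<close>, and \<open>T\<^sup>n w \<longlonglongrightarrow> p\<close> by compactness.  Continuity of \<open>T\<^sup>n\<close> at \<open>p\<close>
  for large \<open>n\<close> gives \<open>T\<^sup>n p = p\<close> for all large \<open>n\<close>, and two consecutive such \<open>n\<close> give
  \<open>T p = p\<close> (\<open>orbit_limit_fixed\<close>).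
\<close>

section \<open>Cluster points of orbits\<close>

text \<open>
  The times \<open>r\<close> tend to infinity but need not increase, so that differences of two sequences of
  times can serve as times without passing to a further subsequence.
\<close>

definition orbit_limits :: "('a::topological_space \<Rightarrow> 'a) \<Rightarrow> 'a \<Rightarrow> 'a set" where
  "orbit_limits T x =
     {y. \<exists>r. filterlim r at_top sequentially \<and> (\<lambda>k. (T ^^ r k) x) \<longlonglongrightarrow> y}"

lemma orbit_limitsI:
  assumes "filterlim r at_top sequentially" and "(\<lambda>k. (T ^^ r k) x) \<longlonglongrightarrow> y"
  shows "y \<in> orbit_limits T x"
  using assms unfolding orbit_limits_def by (intro CollectI exI conjI)

lemma orbit_limitsE:
  assumes "y \<in> orbit_limits T x"
  obtains r where "filterlim r at_top sequentially" and "(\<lambda>k. (T ^^ r k) x) \<longlonglongrightarrow> y"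
  using assms unfolding orbit_limits_def mem_Collect_eq by (elim exE conjE) (rule that)

lemma funpow_mem:
  assumes "T \<in> C \<rightarrow> C" and "x \<in> C"
  shows "(T ^^ n) x \<in> C"
  using assms by (induction n) auto

lemma pointwise_asymptotically_nonexpansive_onE:
  assumes "pointwise_asymptotically_nonexpansive_on C T" and "x \<in> C"
  obtains \<alpha> :: "nat \<Rightarrow> real" where "\<alpha> \<longlonglongrightarrow> 1"
    and "\<forall>\<^sub>F n in sequentially. \<forall>y\<in>C. dist ((T ^^ n) x) ((T ^^ n) y) \<le> \<alpha> n * dist x y"
proof -
  have "\<forall>x\<in>C. \<exists>(N::nat) (\<alpha>::nat \<Rightarrow> real). \<alpha> \<longlonglongrightarrow> 1 \<and>
      (\<forall>n\<ge>N. \<forall>y\<in>C. norm ((T ^^ n) x - (T ^^ n) y) \<le> \<alpha> n * norm (x - y))"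
    using assms(1) unfolding pointwise_asymptotically_nonexpansive_on_def by (rule conjunct2)
  from bspec[OF this \<open>x \<in> C\<close>] obtain N \<alpha> where "\<alpha> \<longlonglongrightarrow> (1::real)"
    and "\<forall>n\<ge>N. \<forall>y\<in>C. norm ((T ^^ n) x - (T ^^ n) y) \<le> \<alpha> n * norm (x - y)"
    by (elim exE conjE)
  then show thesis
    by (intro that) (auto simp: eventually_sequentially dist_norm)
qed

lemma orbit_limits_nonempty:
  fixes C :: "'a::metric_space set"
  assumes "compact C" and "T \<in> C \<rightarrow> C" and "x \<in> C"
  shows "orbit_limits T x \<noteq> {}"
proof -
  have "\<forall>n. (T ^^ n) x \<in> C"
    using funpow_mem[OF assms(2,3)] by simp
  then obtain l r where "l \<in> C" and "strict_mono (r :: nat \<Rightarrow> nat)"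
    and "((\<lambda>n. (T ^^ n) x) \<circ> r) \<longlonglongrightarrow> l"
    by (rule seq_compactE[OF compact_imp_seq_compact[OF \<open>compact C\<close>]])
  then have "l \<in> orbit_limits T x"
    unfolding o_def by (intro orbit_limitsI[OF filterlim_subseq])
  then show ?thesis by blast
qed

lemma orbit_limits_subset:
  fixes C :: "'a::first_countable_topology set"
  assumes "closed C" and "T \<in> C \<rightarrow> C" and "x \<in> C"
  shows "orbit_limits T x \<subseteq> C"
proof
  fix y assume "y \<in> orbit_limits T x"
  then obtain r where "(\<lambda>k. (T ^^ r k) x) \<longlonglongrightarrow> y"
    by (rule orbit_limitsE)
  moreover have "(T ^^ r k) x \<in> C" for k
    using funpow_mem[OF assms(2,3)] .
  ultimately show "y \<in> C"
    using closed_sequentially[OF \<open>closed C\<close>, of "\<lambda>k. (T ^^ r k) x" y] by simp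
qed

lemma compact_LIMSEQ_unique_orbit_limit:
  fixes C :: "'a::metric_space set"
  assumes "compact C" and "T \<in> C \<rightarrow> C" and "x \<in> C" and "orbit_limits T x \<subseteq> {p}"
  shows "(\<lambda>n. (T ^^ n) x) \<longlonglongrightarrow> p"
proof (rule ccontr)
  assume "\<not> ?thesis"
  then obtain e where "e > 0" and e: "\<not> (\<forall>\<^sub>F n in sequentially. dist ((T ^^ n) x) p < e)"
    unfolding tendsto_iff by blast
  then have "infinite {n. e \<le> dist ((T ^^ n) x) p}"
    by (simp add: cofinite_eq_sequentially[symmetric] eventually_cofinite not_less)
  then obtain s where s: "strict_mono (s :: nat \<Rightarrow> nat)" "\<And>k. e \<le> dist ((T ^^ s k) x) p"
    using infinite_enumerate by blast
  have "\<forall>k. (T ^^ s k) x \<in> C"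
    using funpow_mem[OF assms(2,3)] by simp
  then obtain q l where "q \<in> C" and l: "strict_mono (l :: nat \<Rightarrow> nat)"
    and q: "((\<lambda>k. (T ^^ s k) x) \<circ> l) \<longlonglongrightarrow> q"
    by (rule seq_compactE[OF compact_imp_seq_compact[OF \<open>compact C\<close>]])
  have "strict_mono (s \<circ> l)"
    using s(1) l strict_mono_o by blast
  then have "q \<in> orbit_limits T x"
    using q unfolding o_def by (intro orbit_limitsI[OF filterlim_subseq])
  then have "q = p" using assms by blast
  have "(\<lambda>k. dist ((T ^^ s (l k)) x) p) \<longlonglongrightarrow> dist q p"
    using q unfolding o_def by (intro tendsto_intros)
  then have "e \<le> dist q p"
    by (rule LIMSEQ_le_const) (use s(2) in auto)
  then show False using \<open>q = p\<close> \<open>e > 0\<close> by simp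
qed

section \<open>A centre of radius smaller than the diameter\<close>

text \<open>
  The centroid of a finite net of mesh half the diameter works: each point of \<open>M\<close> is close to at
  least one net point, and this one short distance pulls the average of the distances below the
  diameter by a fixed amount.
\<close>

lemma convex_hull_center_beats_diameter:
  fixes M :: "'a::real_normed_vector set"
  assumes "compact (closure M)" and "0 < diameter M"
  obtains u r where "u \<in> convex hull M" and "r < diameter M" and "\<And>m. m \<in> M \<Longrightarrow> dist u m \<le> r"
proof -
  define d where "d = diameter M"
  have "d > 0" using assms d_def by simp
  have bnd: "bounded M"
    using bounded_subset[OF compact_imp_bounded[OF assms(1)] closure_subset] .
  have cov: "closure M \<subseteq> (\<Union>x\<in>M. ball x (d/2))"
  proof
    fix y assume "y \<in> closure M"
    then obtain x where "x \<in> M" "dist x y < d/2"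
      using \<open>d > 0\<close> closure_approachable[of y M] half_gt_zero[of d] by blast
    then show "y \<in> (\<Union>x\<in>M. ball x (d/2))" by auto
  qed
  obtain F where F: "F \<subseteq> M" "finite F" "closure M \<subseteq> (\<Union>x\<in>F. ball x (d/2))"
    using compactE_image[OF assms(1) _ cov] open_ball by blast
  have "M \<noteq> {}" using assms(2) by auto
  then have "F \<noteq> {}" using F(3) closure_subset[of M] by auto
  define c where "c = real (card F)"
  have "c > 0" using \<open>F \<noteq> {}\<close> F c_def by (simp add: card_gt_0_iff)
  define u where "u = (\<Sum>x\<in>F. (1/c) *\<^sub>R x)"
  have "u \<in> convex hull M"
    unfolding u_def
  proof (rule convex_sum)
    show "(\<Sum>i\<in>F. 1 / c) = 1" using \<open>c > 0\<close> by (simp add: c_def)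
    show "i \<in> convex hull M" if "i \<in> F" for i using that F hull_subset by fast
  qed (use F \<open>c > 0\<close> in auto)
  moreover have "dist u m \<le> d - d / (2*c)" if "m \<in> M" for m
  proof -
    obtain z where z: "z \<in> F" "dist z m < d/2"
      using F(3) subsetD[OF closure_subset \<open>m \<in> M\<close>] by (meson UN_E mem_ball subsetD)
    have "(\<Sum>x\<in>F. (1/c) *\<^sub>R m) = m"
      using \<open>c > 0\<close> by (simp add: c_def sum_constant_scaleR)
    then have "u - m = (\<Sum>x\<in>F. (1/c) *\<^sub>R (x - m))"
      unfolding u_def by (simp add: scaleR_diff_right sum_subtractf)
    then have "dist u m \<le> (\<Sum>x\<in>F. norm ((1/c) *\<^sub>R (x - m)))"
      unfolding dist_norm by (simp only: norm_sum)
    also have "\<dots> = (\<Sum>x\<in>F. dist x m) / c"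
      using \<open>c > 0\<close> by (simp add: dist_norm sum_divide_distrib)
    also have "\<dots> \<le> (c * d - d/2) / c"
    proof (rule divide_right_mono)
      have "(\<Sum>x\<in>F. dist x m) = dist z m + (\<Sum>x\<in>F - {z}. dist x m)"
        using sum.remove[OF F(2) z(1)] .
      also have "\<dots> \<le> d/2 + (\<Sum>x\<in>F - {z}. d)"
      proof (intro add_mono sum_mono)
        show "dist x m \<le> d" if "x \<in> F - {z}" for x
          using diameter_bounded_bound[OF bnd, of x m] that F(1) \<open>m \<in> M\<close> d_def by auto
      qed (use z in auto)
      also have "\<dots> = d/2 + (c * d - d)"
        using sum.remove[OF F(2) z(1), of "\<lambda>_. d"] by (simp add: c_def)
      finally show "(\<Sum>x\<in>F. dist x m) \<le> c * d - d/2" by simp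
    qed (use \<open>c > 0\<close> in simp)
    also have "\<dots> = d - d / (2*c)"
      using \<open>c > 0\<close> by (simp add: field_simps)
    finally show ?thesis .
  qed
  moreover have "d - d / (2*c) < diameter M"
    using \<open>d > 0\<close> \<open>c > 0\<close> d_def by simp
  ultimately show thesis using that by blast
qed

section \<open>Limiting nonexpansiveness and limits of orbits\<close>

text \<open>
  A cluster point \<open>m\<close> of the orbit of \<open>w\<close> is approached by \<open>T\<^sup>n w\<close> at times \<open>n\<close> far beyond any
  prescribed time, so it can be reached from a late point of the same orbit in exactly the number
  of steps that \<open>x\<close> needs to come close to \<open>y\<close>.  These late points accumulate at some \<open>m'\<close> in
  the same cluster set, and the limiting nonexpansiveness at \<open>x\<close> bounds \<open>dist y m\<close> by \<open>dist x m'\<close>.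
\<close>

lemma orbit_limits_near_orbit_limits:
  fixes C :: "'a::real_normed_vector set"
  assumes "compact C" and T: "pointwise_asymptotically_nonexpansive_on C T"
    and "x \<in> C" and "w \<in> C"
    and y: "y \<in> orbit_limits T x" and m: "m \<in> orbit_limits T w"
  shows "\<exists>m'\<in>orbit_limits T w. dist y m \<le> dist x m'"
proof -
  have self: "T \<in> C \<rightarrow> C"
    using T unfolding pointwise_asymptotically_nonexpansive_on_def by blast
  obtain r where r: "filterlim r at_top sequentially" "(\<lambda>k. (T ^^ r k) x) \<longlonglongrightarrow> y"
    using y by (rule orbit_limitsE)
  obtain s where s: "filterlim s at_top sequentially" "(\<lambda>k. (T ^^ s k) w) \<longlonglongrightarrow> m"
    using m by (rule orbit_limitsE)
  \<comment> \<open>The margin \<open>k\<close> beyond \<open>r k\<close> makes the remaining times \<open>n k - r k\<close> tend to infinity.\<close>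
  have "\<exists>n. r k + k \<le> n \<and> dist ((T ^^ n) w) m < inverse (Suc k)" for k
  proof -
    have "\<forall>\<^sub>F j in sequentially. r k + k \<le> s j"
      using s(1) unfolding filterlim_at_top by blast
    moreover have "\<forall>\<^sub>F j in sequentially. dist ((T ^^ s j) w) m < inverse (Suc k)"
      using tendstoD[OF s(2), of "inverse (Suc k)"] by simp
    ultimately have "\<forall>\<^sub>F j in sequentially. r k + k \<le> s j \<and> dist ((T ^^ s j) w) m < inverse (Suc k)"
      by (rule eventually_conj)
    then show ?thesis
      using eventually_happens' sequentially_bot by blast
  qed
  then obtain n where n: "\<And>k. r k + k \<le> n k"
      "\<And>k. dist ((T ^^ n k) w) m < inverse (Suc k)"
    by metis
  define v where "v k = (T ^^ (n k - r k)) w" for k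
  have step: "(T ^^ r k) (v k) = (T ^^ n k) w" for k
    using n(1)[of k] funpow_add[of "r k" "n k - r k" T] by (simp add: v_def)
  have vC: "\<forall>k. v k \<in> C"
    using funpow_mem[OF self \<open>w \<in> C\<close>] v_def by simp
  then obtain m' l where "m' \<in> C" and l: "strict_mono (l :: nat \<Rightarrow> nat)" and m': "(v \<circ> l) \<longlonglongrightarrow> m'"
    by (rule seq_compactE[OF compact_imp_seq_compact[OF \<open>compact C\<close>]])
  have "filterlim (\<lambda>k. n k - r k) at_top sequentially"
  proof (rule filterlim_at_top_mono[OF filterlim_ident])
    show "\<forall>\<^sub>F k in sequentially. k \<le> n k - r k"
    proof (intro always_eventually allI)
      show "k \<le> n k - r k" for k using n(1)[of k] by linarith
    qed
  qed
  then have "filterlim (\<lambda>k. n (l k) - r (l k)) at_top sequentially"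
    using filterlim_subseq[OF l] by (rule filterlim_compose)
  then have m'_limit: "m' \<in> orbit_limits T w"
    using m' unfolding v_def o_def by (rule orbit_limitsI)
  obtain \<alpha> where \<alpha>: "\<alpha> \<longlonglongrightarrow> (1::real)"
    "\<forall>\<^sub>F n in sequentially. \<forall>y\<in>C. dist ((T ^^ n) x) ((T ^^ n) y) \<le> \<alpha> n * dist x y"
    using pointwise_asymptotically_nonexpansive_onE[OF T \<open>x \<in> C\<close>] by blast
  have rl: "filterlim (\<lambda>k. r (l k)) at_top sequentially"
    using filterlim_compose[OF r(1) filterlim_subseq[OF l]] .
  have le: "\<forall>\<^sub>F k in sequentially.
      dist ((T ^^ r (l k)) x) ((T ^^ n (l k)) w) \<le> \<alpha> (r (l k)) * dist x (v (l k))"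
    using eventually_compose_filterlim[OF \<alpha>(2) rl]
    by eventually_elim (use vC step in metis)
  have "(\<lambda>k. \<alpha> (r (l k)) * dist x (v (l k))) \<longlonglongrightarrow> 1 * dist x m'"
    using m' unfolding o_def by (intro tendsto_intros filterlim_compose[OF \<alpha>(1) rl])
  moreover have "(\<lambda>k. (T ^^ n k) w) \<longlonglongrightarrow> m"
  proof (rule metric_tendsto_imp_tendsto[OF LIMSEQ_inverse_real_of_nat])
    show "\<forall>\<^sub>F k in sequentially. dist ((T ^^ n k) w) m \<le> dist (inverse (real (Suc k))) 0"
      using n(2) by (intro always_eventually) (simp add: less_imp_le)
  qed
  then have "(\<lambda>k. dist ((T ^^ r (l k)) x) ((T ^^ n (l k)) w)) \<longlonglongrightarrow> dist y m"
    by (intro tendsto_dist filterlim_compose[OF r(2) filterlim_subseq[OF l]]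
        filterlim_compose[OF _ filterlim_subseq[OF l]])
  ultimately have "dist y m \<le> 1 * dist x m'"
    using le by (rule tendsto_le[OF sequentially_bot])
  then show ?thesis using m'_limit by auto
qed

text \<open>
  Convergence of a full orbit, rather than of a subsequence of it, is what makes the limit
  invariant: \<open>T\<^sup>n p\<close> and \<open>p\<close> are both limits of \<open>T\<^sup>n\<^sup>+\<^sup>k w\<close> as \<open>k\<close> grows, for each large \<open>n\<close>.
\<close>

lemma orbit_limit_fixed:
  fixes C :: "'a::real_normed_vector set"
  assumes T: "pointwise_asymptotically_nonexpansive_on C T"
    and "w \<in> C" and "p \<in> C" and conv: "(\<lambda>n. (T ^^ n) w) \<longlonglongrightarrow> p"
  shows "T p = p"
proof -
  have self: "T \<in> C \<rightarrow> C"
    using T unfolding pointwise_asymptotically_nonexpansive_on_def by blast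
  obtain \<alpha> where
    "\<forall>\<^sub>F n in sequentially. \<forall>y\<in>C. dist ((T ^^ n) p) ((T ^^ n) y) \<le> \<alpha> n * dist p y"
    using pointwise_asymptotically_nonexpansive_onE[OF T \<open>p \<in> C\<close>] by blast
  then obtain N where N: "\<And>n y. n \<ge> N \<Longrightarrow> y \<in> C \<Longrightarrow>
      dist ((T ^^ n) p) ((T ^^ n) y) \<le> \<alpha> n * dist p y"
    unfolding eventually_sequentially by blast
  have fix_large: "(T ^^ n) p = p" if "n \<ge> N" for n
  proof -
    have "(\<lambda>k. dist ((T ^^ n) p) ((T ^^ (k + n)) w)) \<longlonglongrightarrow> dist ((T ^^ n) p) p"
      using LIMSEQ_ignore_initial_segment[OF conv] by (intro tendsto_intros)
    moreover have "(\<lambda>k. \<alpha> n * dist p ((T ^^ k) w)) \<longlonglongrightarrow> \<alpha> n * dist p p"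
      by (intro tendsto_intros conv)
    moreover have "dist ((T ^^ n) p) ((T ^^ (k + n)) w) \<le> \<alpha> n * dist p ((T ^^ k) w)" for k
      using N[OF that funpow_mem[OF self \<open>w \<in> C\<close>, of k]] funpow_add[of n k T]
      by (simp add: add.commute)
    ultimately have "dist ((T ^^ n) p) p \<le> \<alpha> n * dist p p"
      by (meson LIMSEQ_le)
    then show ?thesis by simp
  qed
  have "T p = T ((T ^^ N) p)" by (simp add: fix_large)
  also have "\<dots> = (T ^^ Suc N) p" by simp
  also have "\<dots> = p" using fix_large[of "Suc N"] by simp
  finally show ?thesis .
qed

section \<open>Minimal sets and the fixed point\<close>

text \<open>
  Being closed under \<open>orbit_limits T\<close> passes to arbitrary intersections, and compactness keeps the
  intersection of a chain nonempty, so Zorn's lemma applies to reverse inclusion.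
\<close>

lemma minimal_compact_convex_orbit_limits_closed:
  fixes C :: "'a::real_normed_vector set"
  assumes "C \<noteq> {}" and "compact C" and "convex C" and "T \<in> C \<rightarrow> C"
  obtains K where "K \<subseteq> C" and "K \<noteq> {}" and "compact K" and "convex K"
    and "\<And>x. x \<in> K \<Longrightarrow> orbit_limits T x \<subseteq> K"
    and "\<And>L. \<lbrakk>L \<subseteq> K; L \<noteq> {}; compact L; convex L; \<And>x. x \<in> L \<Longrightarrow> orbit_limits T x \<subseteq> L\<rbrakk> \<Longrightarrow> L = K"
proof -
  define \<A> where "\<A> = {K. K \<subseteq> C \<and> K \<noteq> {} \<and> compact K \<and> convex K \<and> (\<forall>x\<in>K. orbit_limits T x \<subseteq> K)}"
  have CA: "C \<in> \<A>"
    using assms orbit_limits_subset[OF compact_imp_closed[OF assms(2)] assms(4)]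
    unfolding \<A>_def by simp
  have "\<exists>K\<in>\<A>. \<forall>L\<in>\<A>. L \<subseteq> K \<longrightarrow> L = K"
  proof (rule predicate_Zorn)
    show "partial_order_on \<A> (relation_of (\<lambda>K L. L \<subseteq> K) \<A>)"
      by (rule partial_order_on_relation_ofI) auto
    fix \<C> assume "\<C> \<in> Chains (relation_of (\<lambda>K L. L \<subseteq> K) \<A>)"
    then have sub: "\<C> \<subseteq> \<A>" and chain: "\<And>K L. \<lbrakk>K \<in> \<C>; L \<in> \<C>\<rbrakk> \<Longrightarrow> K \<subseteq> L \<or> L \<subseteq> K"
      unfolding Chains_def relation_of_def by blast+
    show "\<exists>u\<in>\<A>. \<forall>K\<in>\<C>. u \<subseteq> K"
    proof (cases "\<C> = {}")
      case True
      then show ?thesis using CA by blast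
    next
      case False
      have cpt: "\<And>K. K \<in> \<C> \<Longrightarrow> compact K"
        using sub unfolding \<A>_def by auto
      have "C \<inter> \<Inter>\<C> \<noteq> {}"
      proof (rule compact_imp_fip[OF \<open>compact C\<close> compact_imp_closed[OF cpt]])
        fix \<B> assume \<B>: "finite \<B>" "\<B> \<subseteq> \<C>"
        show "C \<inter> \<Inter>\<B> \<noteq> {}"
        proof (cases "\<B> = {}")
          case True
          then show ?thesis using \<open>C \<noteq> {}\<close> by simp
        next
          case False
          then obtain K where "K \<in> \<B>" and "\<forall>L\<in>\<B>. L \<subseteq> K \<longrightarrow> K = L"
            using finite_has_minimal[OF \<open>finite \<B>\<close>] by blast
          then have "K \<subseteq> \<Inter>\<B>" using chain \<B>(2) by blast
          moreover have "K \<in> \<A>" using \<open>K \<in> \<B>\<close> \<B>(2) sub by blast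
          ultimately show ?thesis unfolding \<A>_def by blast
        qed
      qed
      moreover have "compact (C \<inter> \<Inter>\<C>)"
        using cpt by (intro compact_Int_closed[OF \<open>compact C\<close>] closed_Inter) (simp add: compact_imp_closed)
      moreover have "\<Inter>\<C> \<subseteq> C"
        using sub False unfolding \<A>_def by blast
      then have "C \<inter> \<Inter>\<C> = \<Inter>\<C>" by blast
      moreover have "convex (\<Inter>\<C>)"
        using sub unfolding \<A>_def by (intro convex_Inter) auto
      moreover have "\<forall>x\<in>\<Inter>\<C>. orbit_limits T x \<subseteq> \<Inter>\<C>"
        using sub unfolding \<A>_def by blast
      ultimately have "\<Inter>\<C> \<in> \<A>"
        using \<open>\<Inter>\<C> \<subseteq> C\<close> unfolding \<A>_def by simp
      then show ?thesis by blast
    qed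
  qed
  then obtain K where "K \<in> \<A>" and min: "\<And>L. L \<in> \<A> \<Longrightarrow> L \<subseteq> K \<Longrightarrow> L = K" by blast
  show thesis
  proof (rule that[of K])
    show "L = K" if "L \<subseteq> K" "L \<noteq> {}" "compact L" "convex L" "\<And>x. x \<in> L \<Longrightarrow> orbit_limits T x \<subseteq> L" for L
      using that \<open>K \<in> \<A>\<close> by (intro min) (auto simp: \<A>_def)
  qed (use \<open>K \<in> \<A>\<close> in \<open>auto simp: \<A>_def\<close>)
qed

theorem corollary5p5:
  fixes C :: "'a::banach set" and T :: "'a \<Rightarrow> 'a"
  assumes "C \<noteq> {}" and "compact C" and "convex C"
    and "pointwise_asymptotically_nonexpansive_on C T"
  shows "\<exists>x\<in>C. T x = x"
proof -
  note T = assms(4)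
  have self: "T \<in> C \<rightarrow> C"
    using T unfolding pointwise_asymptotically_nonexpansive_on_def by blast
  obtain K where K: "K \<subseteq> C" "K \<noteq> {}" "compact K" "convex K"
    and inv: "\<And>x. x \<in> K \<Longrightarrow> orbit_limits T x \<subseteq> K"
    and min: "\<And>L. \<lbrakk>L \<subseteq> K; L \<noteq> {}; compact L; convex L; \<And>x. x \<in> L \<Longrightarrow> orbit_limits T x \<subseteq> L\<rbrakk> \<Longrightarrow> L = K"
    using minimal_compact_convex_orbit_limits_closed[OF assms(1-3) self] by blast
  obtain w where "w \<in> K" using K by blast
  then have "w \<in> C" using K by blast
  define M where "M = orbit_limits T w"
  have "M \<subseteq> K" using inv \<open>w \<in> K\<close> M_def by blast
  have "closure M \<subseteq> K"
    using \<open>M \<subseteq> K\<close> K closure_minimal compact_imp_closed by blast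
  then have cM: "compact (closure M)"
    using K by (metis closed_closure compact_Int_closed inf.absorb2)
  have bM: "bounded M"
    using bounded_subset[OF compact_imp_bounded[OF K(3)] \<open>M \<subseteq> K\<close>] .
  have "\<not> 0 < diameter M"
  proof
    assume "0 < diameter M"
    then obtain u r where u: "u \<in> convex hull M" "r < diameter M" "\<And>m. m \<in> M \<Longrightarrow> dist u m \<le> r"
      using convex_hull_center_beats_diameter[OF cM] by blast
    \<comment> \<open>Minimality forces \<open>D = K\<close>, although two points of \<open>M\<close> lie farther apart than \<open>r\<close>.\<close>
    define D where "D = K \<inter> (\<Inter>m\<in>M. cball m r)"
    have "D = K"
    proof (rule min)
      have "u \<in> K" using u(1) \<open>M \<subseteq> K\<close> K(4) hull_minimal by blast
      then have "u \<in> D" using u(3) by (auto simp: D_def dist_commute)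
      then show "D \<noteq> {}" by blast
      show "compact D"
        unfolding D_def using K by (intro compact_Int_closed closed_INT) auto
      show "convex D"
        unfolding D_def using K by (intro convex_Int convex_INT) auto
      show "orbit_limits T x \<subseteq> D" if "x \<in> D" for x
      proof
        fix y assume y: "y \<in> orbit_limits T x"
        have "x \<in> K" "x \<in> C" using that K unfolding D_def by auto
        have "dist m y \<le> r" if "m \<in> M" for m
        proof -
          obtain m' where "m' \<in> M" "dist y m \<le> dist x m'"
            using orbit_limits_near_orbit_limits[OF assms(2) T \<open>x \<in> C\<close> \<open>w \<in> C\<close> y] \<open>m \<in> M\<close> M_def by blast
          moreover have "dist m' x \<le> r" using \<open>x \<in> D\<close> \<open>m' \<in> M\<close> by (auto simp: D_def)
          ultimately show ?thesis by (simp add: dist_commute)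
        qed
        then show "y \<in> D" using inv[OF \<open>x \<in> K\<close>] y by (auto simp: D_def)
      qed
    qed (auto simp: D_def)
    then have "dist m m' \<le> r" if "m \<in> M" "m' \<in> M" for m m'
      using that \<open>M \<subseteq> K\<close> by (auto simp: D_def set_eq_iff)
    moreover have "M \<noteq> {}" using \<open>0 < diameter M\<close> by auto
    ultimately have "diameter M \<le> r"
      by (intro diameter_le) (auto simp: dist_norm)
    then show False using u(2) by simp
  qed
  moreover obtain p where "p \<in> M"
    using orbit_limits_nonempty[OF assms(2) self \<open>w \<in> C\<close>] M_def by blast
  ultimately have "M \<subseteq> {p}"
    using diameter_bounded_bound[OF bM] by (metis dist_le_zero_iff dual_order.trans not_less singletonI subsetI)
  then have "(\<lambda>n. (T ^^ n) w) \<longlonglongrightarrow> p"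
    using compact_LIMSEQ_unique_orbit_limit[OF assms(2) self \<open>w \<in> C\<close>] M_def by blast
  moreover have "p \<in> C" using \<open>p \<in> M\<close> \<open>M \<subseteq> K\<close> K by blast
  ultimately show ?thesis
    using orbit_limit_fixed[OF T \<open>w \<in> C\<close>] by blast
qed

end
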